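(* Let $G$ be a finite group. For $n\ge0$ let $G^{(n)}=\{(g_1,\dots,g_n)\in G^n : g_ig_j=g_jg_i \text{ for all } 1\le i,j\le n\}$ (so $G^{(0)}$ has one element), and let $c_n$ be the number of orbits of $G$ acting on $G^{(n)}$ by simultaneous conjugation $g\cdot(x_1,\dots,x_n)=(gx_1g^{-1},\dots,gx_ng^{-1})$. Then the formal power series $h_G(t)=\sum_{n=0}^\infty c_nt^n$ is a rational function of $t$. *)

theory Defs
  imports
    "HOL-Algebra.Group_Action"
    "HOL-Computational_Algebra.Polynomial_FPS"
    "HOL-Computational_Algebra.Formal_Laurent_Series"
begin

text \<open>An $n$-tuple of group elements is a list of length $n$, so the only $0$-tuple is the empty list.\<close>

definition commuting_tuples :: "('a, 'b) monoid_scheme \<Rightarrow> nat \<Rightarrow> 'a list set" where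
  "commuting_tuples G n =
     {xs. length xs = n \<and> set xs \<subseteq> carrier G \<and>
          (\<forall>i<n. \<forall>j<n. xs ! i \<otimes>\<^bsub>G\<^esub> xs ! j = xs ! j \<otimes>\<^bsub>G\<^esub> xs ! i)}"

definition simult_conj :: "('a, 'b) monoid_scheme \<Rightarrow> 'a \<Rightarrow> 'a list \<Rightarrow> 'a list" where
  "simult_conj G g xs = map (\<lambda>x. g \<otimes>\<^bsub>G\<^esub> x \<otimes>\<^bsub>G\<^esub> inv\<^bsub>G\<^esub> g) xs"

definition num_conj_orbits :: "('a, 'b) monoid_scheme \<Rightarrow> nat \<Rightarrow> nat" where
  "num_conj_orbits G n = card (orbits G (commuting_tuples G n) (simult_conj G))"

definition commuting_series :: "('a, 'b) monoid_scheme \<Rightarrow> rat fps" where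
  "commuting_series G = Abs_fps (\<lambda>n. of_nat (num_conj_orbits G n))"

text \<open>
  A power series over a field $K$ is a rational function if it lies in the image of $K(t)$ in the
  field $K((t))$ of formal Laurent series. The quotient is taken in \<^typ>\<open>'a fls\<close>, where it is
  genuine field division; division on \<^typ>\<open>'a fps\<close> discards terms of negative degree.
\<close>

definition rational_fps :: "'a::field fps \<Rightarrow> bool" where
  "rational_fps f \<longleftrightarrow>
     (\<exists>p q :: 'a poly. q \<noteq> 0 \<and>
        fps_to_fls f = fps_to_fls (fps_of_poly p) / fps_to_fls (fps_of_poly q))"

end

theory Submission
  imports Defs
begin

text \<open>
  A tuple is fixed by conjugation with \<open>g\<close> exactly if \<open>g\<close> can be prepended to it, so
  Burnside's lemma gives \<open>c\<^sub>n = a\<^sub>n\<^sub>+\<^sub>1 / |G|\<close>, where \<open>a\<^sub>n\<close> is the number of commuting \<open>n\<close>-tuples.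
  Sorting the tuples by their set \<open>S\<close> of entries, which ranges over the finitely many commuting
  subsets of \<open>G\<close>, it remains to count the tuples whose set of entries is exactly \<open>S\<close>.
  There are \<open>|S|\<^sup>n\<close> tuples with entries in \<open>S\<close>, and induction over the proper subsets of \<open>S\<close> turns this into a linear combination of geometric series.
\<close>

section \<open>Rational power series\<close>

text \<open>In the field of Laurent series the nonzero denominator can be multiplied across, and
  \<open>fps_to_fls\<close> is injective and multiplicative. Closure properties can thus be checked
  in the ring of power series.\<close>

lemma rational_fps_iff:
  "rational_fps f \<longleftrightarrow> (\<exists>p q. q \<noteq> 0 \<and> f * fps_of_poly q = fps_of_poly p)"
proof -
  have "fps_to_fls f = fps_to_fls (fps_of_poly p) / fps_to_fls (fps_of_poly q)
      \<longleftrightarrow> f * fps_of_poly q = fps_of_poly p" if "q \<noteq> 0" for p q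
  proof -
    have "fps_to_fls (fps_of_poly q) \<noteq> 0"
      using that by (metis fps_of_poly_0 fps_of_poly_eq_iff fps_to_fls_eq_0_iff)
    then have "fps_to_fls f = fps_to_fls (fps_of_poly p) / fps_to_fls (fps_of_poly q)
        \<longleftrightarrow> fps_to_fls (f * fps_of_poly q) = fps_to_fls (fps_of_poly p)"
      by (simp add: nonzero_eq_divide_eq fls_times_fps_to_fls)
    then show ?thesis
      by simp
  qed
  then show ?thesis
    unfolding rational_fps_def by blast
qed

lemma rational_fps_of_poly: "rational_fps (fps_of_poly p)"
  unfolding rational_fps_iff by (rule exI[of _ p], rule exI[of _ 1]) simp

lemma rational_fps_add:
  assumes "rational_fps f" "rational_fps g"
  shows "rational_fps (f + g)"
proof -
  obtain p q p' q' where q: "q \<noteq> 0" "f * fps_of_poly q = fps_of_poly p"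
    and q': "q' \<noteq> 0" "g * fps_of_poly q' = fps_of_poly p'"
    using assms unfolding rational_fps_iff by blast
  have "(f + g) * fps_of_poly (q * q')
      = (f * fps_of_poly q) * fps_of_poly q' + (g * fps_of_poly q') * fps_of_poly q"
    by (simp add: fps_of_poly_mult algebra_simps)
  also have "\<dots> = fps_of_poly (p * q' + p' * q)"
    by (simp add: q q' fps_of_poly_mult fps_of_poly_add)
  finally show ?thesis
    unfolding rational_fps_iff using q q' by (metis no_zero_divisors)
qed

lemma rational_fps_mult:
  assumes "rational_fps f" "rational_fps g"
  shows "rational_fps (f * g)"
proof -
  obtain p q p' q' where q: "q \<noteq> 0" "f * fps_of_poly q = fps_of_poly p"
    and q': "q' \<noteq> 0" "g * fps_of_poly q' = fps_of_poly p'"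
    using assms unfolding rational_fps_iff by blast
  have "(f * g) * fps_of_poly (q * q') = (f * fps_of_poly q) * (g * fps_of_poly q')"
    by (simp add: fps_of_poly_mult algebra_simps)
  also have "\<dots> = fps_of_poly (p * p')"
    by (simp add: q q' fps_of_poly_mult)
  finally show ?thesis
    unfolding rational_fps_iff using q q' by (metis no_zero_divisors)
qed

lemma rational_fps_const: "rational_fps (fps_const c)"
  by (metis rational_fps_of_poly fps_of_poly_const)

lemma rational_fps_diff:
  assumes "rational_fps f" "rational_fps g"
  shows "rational_fps (f - g)"
proof -
  have "f - g = f + fps_const (- 1) * g"
    by (simp add: fps_eq_iff)
  then show ?thesis
    by (simp only: assms rational_fps_add rational_fps_mult rational_fps_const)
qed

lemma rational_fps_sum:
  assumes "\<And>i. i \<in> I \<Longrightarrow> rational_fps (f i)"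
  shows "rational_fps (\<Sum>i\<in>I. f i)"
  using assms
proof (induction I rule: infinite_finite_induct)
  case (insert i I)
  then show ?case by (simp add: rational_fps_add)
\<comment> \<open>For an empty or infinite \<open>I\<close> the sum is \<open>0\<close>, a constant
  series.\<close>
qed (use rational_fps_const[of 0] in simp_all)

lemma rational_fps_geometric: "rational_fps (Abs_fps (\<lambda>n. c ^ n))"
proof -
  \<comment> \<open>Multiplying by \<open>1 - c * t\<close> telescopes: the coefficient at 0 stays
    1, and every later one is \<open>c ^ n - c * c ^ (n - 1) = 0\<close>.\<close>
  have "Abs_fps (\<lambda>n. c ^ n) * fps_of_poly [:1, - c:] = fps_of_poly 1"
  proof (rule fps_ext)
    fix n
    have "Abs_fps (\<lambda>n. c ^ n) * fps_of_poly [:1, - c:]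
        = Abs_fps (\<lambda>n. c ^ n) - fps_const c * (fps_X * Abs_fps (\<lambda>n. c ^ n))"
      by (simp add: fps_of_poly_linear' algebra_simps flip: fps_const_neg)
    then show "(Abs_fps (\<lambda>n. c ^ n) * fps_of_poly [:1, - c:]) $ n = fps_of_poly 1 $ n"
      by (cases n) simp_all
  qed
  then show ?thesis
    unfolding rational_fps_iff by (metis one_neq_zero pCons_eq_0_iff)
qed

section \<open>Lists with a prescribed set of entries\<close>

lemma card_lists_set_mem:
  assumes "finite F" "\<And>S. S \<in> F \<Longrightarrow> finite S"
  shows "card {xs. length xs = n \<and> set xs \<in> F}
    = (\<Sum>S\<in>F. card {xs. length xs = n \<and> set xs = S})"
proof -
  have "{xs. length xs = n \<and> set xs \<in> F} = (\<Union>S\<in>F. {xs. length xs = n \<and> set xs = S})"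
    by auto
  moreover have "finite {xs. length xs = n \<and> set xs = S}" if "S \<in> F" for S
    using finite_lists_length_eq[OF assms(2)[OF that], of n]
    by (rule rev_finite_subset) auto
  ultimately show ?thesis
    using assms(1) by (simp add: card_UN_disjoint disjoint_iff)
qed

text \<open>The lists over \<open>S\<close> are split by their exact set of entries, with
  \<open>S\<close> itself set apart. Writing this as a sum avoids truncated subtraction on
  \<open>nat\<close>.\<close>

lemma card_lists_set_eq:
  assumes "finite S"
  shows "card {xs. length xs = n \<and> set xs = S} + (\<Sum>T\<in>Pow S - {S}. card {xs. length xs = n \<and> set xs = T})
    = card S ^ n"
proof -
  have "card S ^ n = card {xs. length xs = n \<and> set xs \<in> Pow S}"
    using card_lists_length_eq[OF assms, of n] by (simp add: conj_commute)
  also have "\<dots> = (\<Sum>T\<in>Pow S. card {xs. length xs = n \<and> set xs = T})"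
    using assms by (intro card_lists_set_mem) (auto intro: finite_subset)
  also have "\<dots> = card {xs. length xs = n \<and> set xs = S}
      + (\<Sum>T\<in>Pow S - {S}. card {xs. length xs = n \<and> set xs = T})"
    using assms by (intro sum.remove) auto
  finally show ?thesis by simp
qed

text \<open>The length is \<open>Suc n\<close> because \<open>num_conj_orbits G n\<close> is
  obtained from the commuting tuples of length \<open>Suc n\<close>.\<close>

lemma rational_fps_lists_set_eq:
  assumes "finite S"
  shows "rational_fps (Abs_fps (\<lambda>n. of_nat (card {xs. length xs = Suc n \<and> set xs = S})) :: 'b::field fps)"
  using assms
proof (induction S rule: finite_psubset_induct)
  case (psubset S)
  let ?N = "\<lambda>T n. card {xs. length xs = Suc n \<and> set xs = T}"
  let ?c = "of_nat (card S) :: 'b"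
  \<comment> \<open>In a field the count for \<open>S\<close> can be isolated by subtraction; the
    extra factor \<open>?c\<close> comes from the length \<open>Suc n\<close>.\<close>
  have "(of_nat (?N S n) :: 'b) = ?c * ?c ^ n - (\<Sum>T\<in>Pow S - {S}. of_nat (?N T n))" for n
  proof -
    have "?c * ?c ^ n = of_nat (card S ^ Suc n)"
      by simp
    also have "\<dots> = of_nat (?N S n + (\<Sum>T\<in>Pow S - {S}. ?N T n))"
      by (simp only: card_lists_set_eq[OF psubset.hyps])
    finally show ?thesis by simp
  qed
  then have "(Abs_fps (\<lambda>n. of_nat (?N S n)) :: 'b fps)
      = fps_const ?c * Abs_fps (\<lambda>n. ?c ^ n) - (\<Sum>T\<in>Pow S - {S}. Abs_fps (\<lambda>n. of_nat (?N T n)))"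
    by (simp add: fps_eq_iff fps_sum_nth)
  moreover have "rational_fps (Abs_fps (\<lambda>n. of_nat (?N T n)) :: 'b fps)" if "T \<in> Pow S - {S}" for T
    using that by (intro psubset.IH) auto
  ultimately show ?case
    by (simp only: rational_fps_diff rational_fps_mult rational_fps_const rational_fps_geometric
        rational_fps_sum)
qed

section \<open>Simultaneous conjugation\<close>

text \<open>A \<open>group_action\<close> is a homomorphism into \<open>BijGroup E\<close>, whose
  elements are \<open>undefined\<close> outside \<open>E\<close>. A map given on the whole type must
  therefore be restricted first.\<close>

lemma (in group) group_action_restrict:
  assumes closed: "\<And>g x. g \<in> carrier G \<Longrightarrow> x \<in> E \<Longrightarrow> \<phi> g x \<in> E"
    and mult: "\<And>g h x. g \<in> carrier G \<Longrightarrow> h \<in> carrier G \<Longrightarrow> x \<in> E \<Longrightarrow> \<phi> (g \<otimes> h) x = \<phi> g (\<phi> h x)"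
    and one: "\<And>x. x \<in> E \<Longrightarrow> \<phi> \<one> x = x"
  shows "group_action G E (\<lambda>g. restrict (\<phi> g) E)"
proof -
  have Bij: "restrict (\<phi> g) E \<in> Bij E" if g: "g \<in> carrier G" for g
  proof -
    \<comment> \<open>Acting by \<open>inv g\<close> undoes acting by \<open>g\<close>, since both
      composites fold to \<open>\<phi> \<one>\<close>.\<close>
    have "bij_betw (\<phi> g) E E"
      by (rule bij_betw_byWitness[where f' = "\<phi> (inv g)"])
        (auto simp: g closed one simp flip: mult)
    then show ?thesis by (simp add: Bij_def)
  qed
  have "(\<lambda>g. restrict (\<phi> g) E) \<in> hom G (BijGroup E)"
    by (rule homI) (auto simp: BijGroup_def Bij compose_def closed mult fun_eq_iff)
  then show ?thesis
    by (simp add: group_action_def group_hom_def group_hom_axioms_def group_BijGroup is_group)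
qed

text \<open>Orbits of points of \<open>E\<close> evaluate the maps on \<open>E\<close> only. This
  carries Burnside's count back to the unrestricted \<open>simult_conj\<close>.\<close>

lemma orbits_restrict: "orbits G E (\<lambda>g. restrict (\<phi> g) E) = orbits G E \<phi>"
proof -
  have "orbit G (\<lambda>g. restrict (\<phi> g) E) x = orbit G \<phi> x" if "x \<in> E" for x
    using that by (simp add: orbit_def)
  then show ?thesis
    unfolding orbits_def by (intro Collect_cong) auto
qed

text \<open>Pairwise commutation depends only on the set of entries, which permits sorting the
  tuples by that set.\<close>

lemma commuting_tuples_altdef:
  "commuting_tuples G n =
     {xs. length xs = n \<and>
          set xs \<in> {S. S \<subseteq> carrier G \<and> (\<forall>x\<in>S. \<forall>y\<in>S. x \<otimes>\<^bsub>G\<^esub> y = y \<otimes>\<^bsub>G\<^esub> x)}}"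
  unfolding commuting_tuples_def by (auto simp: all_set_conv_all_nth)

context group
begin

lemma finite_commuting_tuples:
  assumes "finite (carrier G)"
  shows "finite (commuting_tuples G n)"
  using finite_lists_length_eq[OF assms, of n]
  by (rule rev_finite_subset) (auto simp: commuting_tuples_def)

text \<open>Used to see that conjugation preserves commutation, hence acts on commuting
  tuples.\<close>

lemma conj_mult:
  assumes "g \<in> carrier G" "x \<in> carrier G" "y \<in> carrier G"
  shows "(g \<otimes> x \<otimes> inv g) \<otimes> (g \<otimes> y \<otimes> inv g) = g \<otimes> (x \<otimes> y) \<otimes> inv g"
proof -
  have "inv g \<otimes> (g \<otimes> (y \<otimes> inv g)) = y \<otimes> inv g"
    using assms by (simp flip: m_assoc)
  then show ?thesis
    using assms by (simp add: m_assoc)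
qed

lemma conj_eq_self_iff:
  assumes "g \<in> carrier G" "x \<in> carrier G"
  shows "g \<otimes> x \<otimes> inv g = x \<longleftrightarrow> g \<otimes> x = x \<otimes> g"
  using assms by (metis inv_solve_right m_closed)

lemma simult_conj_closed:
  assumes "g \<in> carrier G" "xs \<in> commuting_tuples G n"
  shows "simult_conj G g xs \<in> commuting_tuples G n"
  using assms unfolding commuting_tuples_altdef simult_conj_def
  by (auto simp: conj_mult subset_iff)

lemma simult_conj_group_action:
  "group_action G (commuting_tuples G n) (\<lambda>g. restrict (simult_conj G g) (commuting_tuples G n))"
proof (rule group_action_restrict)
  fix g h xs
  assume *: "g \<in> carrier G" "h \<in> carrier G" "xs \<in> commuting_tuples G n"
  then show "simult_conj G (g \<otimes> h) xs = simult_conj G g (simult_conj G h xs)"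
    unfolding commuting_tuples_def simult_conj_def
    by (auto simp: m_assoc inv_mult_group subset_iff)
next
  fix xs assume "xs \<in> commuting_tuples G n"
  then show "simult_conj G \<one> xs = xs"
    unfolding commuting_tuples_def simult_conj_def
    by (auto simp: subset_iff intro!: map_idI)
qed (rule simult_conj_closed)

lemma simult_conj_eq_self_iff:
  assumes "g \<in> carrier G" "set xs \<subseteq> carrier G"
  shows "simult_conj G g xs = xs \<longleftrightarrow> (\<forall>x\<in>set xs. g \<otimes> x = x \<otimes> g)"
proof -
  have "simult_conj G g xs = xs \<longleftrightarrow> (\<forall>x\<in>set xs. g \<otimes> x \<otimes> inv g = x)"
    unfolding simult_conj_def by (induction xs) auto
  then show ?thesis
    using assms conj_eq_self_iff by auto
qed

text \<open>The conditions within \<open>xs\<close> make it a commuting tuple, those between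
  \<open>g\<close> and \<open>xs\<close> say that conjugation by \<open>g\<close> fixes
  \<open>xs\<close>, and \<open>g\<close> commutes with itself.\<close>

lemma Cons_mem_commuting_tuples_iff:
  "g # xs \<in> commuting_tuples G (Suc n) \<longleftrightarrow>
     g \<in> carrier G \<and> xs \<in> commuting_tuples G n \<and> simult_conj G g xs = xs"
proof (cases "g \<in> carrier G \<and> set xs \<subseteq> carrier G")
  case True
  then show ?thesis
    by (auto simp: commuting_tuples_altdef simult_conj_eq_self_iff)
next
  case False
  then show ?thesis
    by (auto simp: commuting_tuples_def)
qed

text \<open>Burnside's lemma counts the pairs of a group element and a tuple fixed by it;
  \<open>Cons\<close> maps these pairs bijectively onto the commuting tuples of length
  \<open>Suc n\<close>.\<close>

lemma num_conj_orbits_mult_order: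
  assumes "finite (carrier G)"
  shows "num_conj_orbits G n * Coset.order G = card (commuting_tuples G (Suc n))"
proof -
  let ?E = "commuting_tuples G n"
  let ?\<phi> = "\<lambda>g. restrict (simult_conj G g) ?E"
  have Cons_image: "(\<lambda>(g, xs). g # xs) ` (SIGMA g : carrier G. invariants ?E ?\<phi> g) = commuting_tuples G (Suc n)"
    (is "?L = ?R")
  proof (rule Set.set_eqI)
    fix ys
    show "ys \<in> ?L \<longleftrightarrow> ys \<in> ?R"
    proof (cases ys)
      case Nil
      then show ?thesis by (auto simp: commuting_tuples_def)
    next
      case (Cons g xs)
      then show ?thesis
        by (auto simp: Cons_mem_commuting_tuples_iff invariants_def image_iff)
    qed
  qed
  have "num_conj_orbits G n * Coset.order G = card (orbits G ?E ?\<phi>) * Coset.order G"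
    by (simp add: num_conj_orbits_def orbits_restrict)
  also have "\<dots> = (\<Sum>g\<in>carrier G. card (invariants ?E ?\<phi> g))"
    by (intro group_action.burnside simult_conj_group_action finite_commuting_tuples assms)
  also have "\<dots> = card (SIGMA g : carrier G. invariants ?E ?\<phi> g)"
    using assms finite_commuting_tuples[OF assms, of n]
    by (intro card_SigmaI[symmetric]) (auto simp: invariants_def)
  also have "\<dots> = card ((\<lambda>(g, xs). g # xs) ` (SIGMA g : carrier G. invariants ?E ?\<phi> g))"
    by (intro card_image[symmetric]) (auto simp: inj_on_def)
  also have "\<dots> = card (commuting_tuples G (Suc n))"
    by (simp only: Cons_image)
  finally show ?thesis .
qed

end

theorem theorem3:
  fixes G (structure)
  assumes "group G" and "finite (carrier G)"
  shows "rational_fps (commuting_series G)"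
proof -
  interpret group G by fact
  define F where "F = {S. S \<subseteq> carrier G \<and> (\<forall>x\<in>S. \<forall>y\<in>S. x \<otimes> y = y \<otimes> x)}"
  let ?N = "\<lambda>S n. card {xs. length xs = Suc n \<and> set xs = S}"
  have F: "finite F" "\<And>S. S \<in> F \<Longrightarrow> finite S"
    using assms(2) by (auto simp: F_def intro: finite_subset)
  have "Coset.order G > 0"
    using assms(2) by (simp add: order_gt_0_iff_finite)
  \<comment> \<open>Each commuting tuple is counted under its set of entries, a member of
    \<open>F\<close>. Neither \<open>F\<close> nor the factor
    \<open>1 / of_nat (Coset.order G)\<close> depends on \<open>n\<close>, so the series is a
    constant times a finite sum of rational series.\<close>
  have "(of_nat (num_conj_orbits G n) :: rat) = 1 / of_nat (Coset.order G) * (\<Sum>S\<in>F. of_nat (?N S n))" for n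
  proof -
    have "(of_nat (num_conj_orbits G n) :: rat) * of_nat (Coset.order G) = of_nat (\<Sum>S\<in>F. ?N S n)"
      by (simp only: num_conj_orbits_mult_order[OF assms(2)] commuting_tuples_altdef
          card_lists_set_mem[OF F] flip: F_def of_nat_mult)
    then show ?thesis
      using \<open>Coset.order G > 0\<close> by (simp add: field_simps)
  qed
  then have "commuting_series G
      = fps_const (1 / of_nat (Coset.order G)) * (\<Sum>S\<in>F. Abs_fps (\<lambda>n. of_nat (?N S n)))"
    by (simp add: commuting_series_def fps_eq_iff fps_sum_nth)
  then show ?thesis
    by (simp only: rational_fps_mult rational_fps_const rational_fps_sum
        rational_fps_lists_set_eq F)
qed

end
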